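(* Let $S=\{1,\dots,n\}$, let $B\subseteq\mathbb{R}^S$ be an integral base-polyhedron and let $\Phi:\mathbb{Z}^S\to\mathbb{R}$ be a symmetric strictly convex function. Then an element $m$ of $B\cap\mathbb{Z}^S$ is a minimizer of $\Phi$ over $B\cap\mathbb{Z}^S$ if and only if $m$ is a decreasingly minimal element of $B\cap\mathbb{Z}^S$.
   Context: An integral base-polyhedron is $B=\{x\in\mathbb{R}^S:\widetilde x(S)=b(S),\ \widetilde x(Z)\le b(Z)\ \forall Z\subseteq S\}$ for an integer-valued submodular $b$ ($+\infty$ allowed) with $b(\emptyset)=0$, $b(S)$ finite; $\widetilde x(Z)=\sum_{s\in Z}x(s)$. $\Phi$ is symmetric if its value is invariant under permuting the coordinates; $\Phi$ is strictly convex if $\lambda\Phi(x)+(1-\lambda)\Phi(y)>\Phi(\lambda x+(1-\lambda)y)$ whenever $x,y\in\mathbb{Z}^S$, $0<\lambda<1$ and $\lambda x+(1-\lambda)y$ is integral. An element $m$ of a set $Q$ is decreasingly minimal if, after sorting components in decreasing order, it is lexicographically smaller than or equal to every $y\in Q$ sorted likewise. (Example: the square-sum $\sum_s z(s)^2$ is symmetric and strictly convex.) *)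

theory Defs
  imports "HOL-Analysis.Analysis" "HOL-Library.Multiset"
begin

text \<open>The ground set \<open>S\<close> is the universe of the finite index type \<open>'n\<close>.\<close>

definition real_vec :: "int ^ 'n \<Rightarrow> real ^ 'n" where
  "real_vec z = (\<chi> s. real_of_int (z $ s))"

definition integral_points :: "(real ^ 'n) set \<Rightarrow> (int ^ 'n) set" where
  "integral_points B = {z. real_vec z \<in> B}"

definition integer_valued :: "('n set \<Rightarrow> ereal) \<Rightarrow> bool" where
  "integer_valued b \<longleftrightarrow> (\<forall>Z. b Z = \<infinity> \<or> (\<exists>k::int. b Z = ereal (real_of_int k)))"

definition submodular :: "('n set \<Rightarrow> ereal) \<Rightarrow> bool" where
  "submodular b \<longleftrightarrow> (\<forall>X Y. b (X \<union> Y) + b (X \<inter> Y) \<le> b X + b Y)"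

definition base_polyhedron :: "('n::finite set \<Rightarrow> ereal) \<Rightarrow> (real ^ 'n) set" where
  "base_polyhedron b =
     {x. ereal (\<Sum>s\<in>UNIV. x $ s) = b UNIV \<and> (\<forall>Z. ereal (\<Sum>s\<in>Z. x $ s) \<le> b Z)}"

definition integral_base_polyhedron :: "(real ^ 'n::finite) set \<Rightarrow> bool" where
  "integral_base_polyhedron B \<longleftrightarrow>
     (\<exists>b. integer_valued b \<and> submodular b \<and> b {} = 0 \<and> b UNIV \<noteq> \<infinity> \<and> B = base_polyhedron b)"

definition symmetric_fun :: "(int ^ 'n \<Rightarrow> real) \<Rightarrow> bool" where
  "symmetric_fun \<Phi> \<longleftrightarrow> (\<forall>\<pi> z. \<pi> permutes UNIV \<longrightarrow> \<Phi> (\<chi> s. z $ \<pi> s) = \<Phi> z)"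

text \<open>The points \<open>x\<close> and \<open>y\<close> must be distinct: for \<open>x = y\<close> the strict inequality is never
  satisfied. Integrality of the convex combination is expressed by the vector \<open>z\<close>.\<close>

definition strictly_convex_int :: "(int ^ 'n \<Rightarrow> real) \<Rightarrow> bool" where
  "strictly_convex_int \<Phi> \<longleftrightarrow>
     (\<forall>x y z. \<forall>l::real. x \<noteq> y \<and> 0 < l \<and> l < 1 \<and>
        real_vec z = l *\<^sub>R real_vec x + (1 - l) *\<^sub>R real_vec y \<longrightarrow>
        l * \<Phi> x + (1 - l) * \<Phi> y > \<Phi> z)"

definition sort_decreasing :: "'a::linorder ^ 'n::finite \<Rightarrow> 'a list" where
  "sort_decreasing x = rev (sorted_list_of_multiset (image_mset (($) x) (mset_set UNIV)))"

definition lex_le :: "'a::linorder list \<Rightarrow> 'a list \<Rightarrow> bool" where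
  "lex_le xs ys \<longleftrightarrow> xs = ys \<or> (xs, ys) \<in> lexord {(a, b). a < b}"

definition dec_min :: "('a::linorder ^ 'n::finite) set \<Rightarrow> 'a ^ 'n \<Rightarrow> bool" where
  "dec_min Q m \<longleftrightarrow> m \<in> Q \<and> (\<forall>y\<in>Q. lex_le (sort_decreasing m) (sort_decreasing y))"

end

theory Submission
  imports Defs
begin

text \<open>
  Call \<open>m\<close> locally minimal if no unit can be moved inside the integral points from a coordinate
  \<open>t\<close> to a coordinate \<open>s\<close> whose value is smaller by at least 2. Such a move strictly decreases
  both \<open>\<Phi>\<close> (the result is a proper convex combination of \<open>y\<close> and \<open>y\<close> with \<open>s\<close>, \<open>t\<close> swapped) and
  the decreasingly sorted vector, so the minimizers of either kind are locally minimal.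
  Conversely, let \<open>m\<close> be locally minimal and \<open>y \<noteq> m\<close>. Simultaneous exchange yields \<open>s\<close> and \<open>t\<close>
  with \<open>y s < m s\<close> and \<open>m t < y t\<close> such that \<open>y + e\<^sub>s - e\<^sub>t\<close> and \<open>m - e\<^sub>s + e\<^sub>t\<close> are feasible.
  Local minimality of \<open>m\<close> gives \<open>y s < m s \<le> m t + 1 \<le> y t\<close>, so \<open>y + e\<^sub>s - e\<^sub>t\<close> is
  at least as good as \<open>y\<close> in both senses, and it is closer to \<open>m\<close>; induct on the distance.
\<close>

section \<open>Unit transfers between two coordinates\<close>

definition transfer :: "int ^ 'n \<Rightarrow> 'n \<Rightarrow> 'n \<Rightarrow> int ^ 'n" where
  "transfer y s t = (\<chi> i. if i = s then y $ i + 1 else if i = t then y $ i - 1 else y $ i)"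

lemma transfer_nth:
  "transfer y s t $ i = (if i = s then y $ i + 1 else if i = t then y $ i - 1 else y $ i)"
  by (simp add: transfer_def)

text \<open>For \<open>s = t\<close> the first branch of \<open>transfer\<close> wins and only the
  unit increase remains, so the total would change; hence the assumption.\<close>

lemma sum_transfer:
  fixes y :: "int ^ 'n::finite"
  assumes "s \<noteq> t"
  shows "(\<Sum>i\<in>Z. transfer y s t $ i) = (\<Sum>i\<in>Z. y $ i) + of_bool (s \<in> Z) - of_bool (t \<in> Z)"
proof -
  have "(\<Sum>i\<in>Z. transfer y s t $ i)
      = (\<Sum>i\<in>Z. y $ i + (if i = s then 1 else 0) - (if i = t then 1 else 0))"
    using assms by (intro sum.cong) (auto simp: transfer_nth)
  also have "\<dots> = (\<Sum>i\<in>Z. y $ i) + of_bool (s \<in> Z) - of_bool (t \<in> Z)"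
    by (simp add: sum.distrib sum_subtractf)
  finally show ?thesis .
qed


subsection \<open>Simultaneous exchange\<close>

locale integral_base =
  fixes b :: "'n::finite set \<Rightarrow> ereal"
  assumes int_val: "integer_valued b" and submod: "submodular b" and b_empty: "b {} = 0"
begin

definition points :: "(int ^ 'n) set" where
  "points = integral_points (base_polyhedron b)"

definition tight :: "int ^ 'n \<Rightarrow> 'n set \<Rightarrow> bool" where
  "tight x Z \<longleftrightarrow> ereal (real_of_int (\<Sum>i\<in>Z. x $ i)) = b Z"

lemma points_iff:
  "x \<in> points \<longleftrightarrow> tight x UNIV \<and> (\<forall>Z. ereal (real_of_int (\<Sum>i\<in>Z. x $ i)) \<le> b Z)"
  by (simp add: points_def integral_points_def base_polyhedron_def real_vec_def tight_def)

lemma points_le: "x \<in> points \<Longrightarrow> ereal (real_of_int (\<Sum>i\<in>Z. x $ i)) \<le> b Z"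
  by (simp add: points_iff)

lemma tight_empty: "tight x {}"
  by (simp add: tight_def b_empty)

text \<open>Submodularity bounds \<open>b (X \<union> Y) + b (X \<inter> Y)\<close> by the sum of
  \<open>x\<close> over \<open>X\<close> plus that over \<open>Y\<close>, which equals the sum over
  the union plus that over the intersection. As neither of these two exceeds its bound, both attain
  it.\<close>

lemma tight_Un_Int:
  assumes x: "x \<in> points" and "tight x X" "tight x Y"
  shows "tight x (X \<union> Y) \<and> tight x (X \<inter> Y)"
proof -
  have "b (X \<union> Y) + b (X \<inter> Y) \<le> b X + b Y"
    using submod by (simp add: submodular_def)
  also have "\<dots> = ereal (real_of_int ((\<Sum>i\<in>X. x $ i) + (\<Sum>i\<in>Y. x $ i)))"
    using assms by (simp add: tight_def flip: plus_ereal.simps)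
  also have "\<dots> = ereal (real_of_int ((\<Sum>i\<in>X \<union> Y. x $ i) + (\<Sum>i\<in>X \<inter> Y. x $ i)))"
    by (simp add: sum.union_inter)
  finally show ?thesis
    using points_le[OF x, of "X \<union> Y"] points_le[OF x, of "X \<inter> Y"] unfolding tight_def
    by (cases "b (X \<union> Y)"; cases "b (X \<inter> Y)") auto
qed

text \<open>Only sets containing \<open>s\<close> but not \<open>t\<close> gain, and they gain one
  unit. Such a set is not tight, and since \<open>b\<close> is integer-valued its slack is at least
  one.\<close>

lemma transfer_in_points:
  assumes y: "y \<in> points" and "s \<noteq> t"
    and no_tight: "\<And>Z. tight y Z \<Longrightarrow> s \<in> Z \<Longrightarrow> t \<in> Z"
  shows "transfer y s t \<in> points"
  unfolding points_iff
proof (intro conjI allI)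
  show "tight (transfer y s t) UNIV"
    using y \<open>s \<noteq> t\<close> by (simp add: points_iff tight_def sum_transfer)
next
  fix Z
  have le: "ereal (real_of_int (\<Sum>i\<in>Z. y $ i)) \<le> b Z"
    by (rule points_le[OF y])
  show "ereal (real_of_int (\<Sum>i\<in>Z. transfer y s t $ i)) \<le> b Z"
  proof (cases "s \<in> Z \<and> t \<notin> Z")
    case True
    with no_tight have "ereal (real_of_int (\<Sum>i\<in>Z. y $ i)) \<noteq> b Z"
      unfolding tight_def by blast
    moreover have "b Z = \<infinity> \<or> (\<exists>k::int. b Z = ereal (real_of_int k))"
      using int_val by (simp add: integer_valued_def)
    ultimately show ?thesis
      using le True by (auto simp: sum_transfer[OF \<open>s \<noteq> t\<close>] simp del: of_int_sum)
  next
    case False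
    then have "(\<Sum>i\<in>Z. transfer y s t $ i) \<le> (\<Sum>i\<in>Z. y $ i)"
      by (auto simp: sum_transfer[OF \<open>s \<noteq> t\<close>])
    then have "ereal (real_of_int (\<Sum>i\<in>Z. transfer y s t $ i)) \<le> ereal (real_of_int (\<Sum>i\<in>Z. y $ i))"
      by (simp only: ereal_less_eq of_int_le_iff)
    with le show ?thesis by (rule order_trans[rotated])
  qed
qed

lemma simultaneous_exchange:
  assumes x: "x \<in> points" and y: "y \<in> points" and s: "y $ s < x $ s"
  obtains t where "x $ t < y $ t" "transfer x t s \<in> points" "transfer y s t \<in> points"
proof -
  \<comment> \<open>\<open>T\<close> will be the least \<open>y\<close>-tight set containing
    \<open>s\<close>; the whole ground set is a candidate. Closure under intersection turns minimal
    cardinality into inclusion in every candidate.\<close>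
  obtain T where T: "tight y T" "s \<in> T"
    and T_min: "\<And>Z. tight y Z \<Longrightarrow> s \<in> Z \<Longrightarrow> card T \<le> card Z"
    using ex_has_least_nat[of "\<lambda>Z. tight y Z \<and> s \<in> Z" UNIV card] y by (auto simp: points_iff)
  \<comment> \<open>Dually, \<open>U\<close> will be the greatest \<open>x\<close>-tight set
    avoiding \<open>s\<close>, with the empty set as a candidate. Every \<open>t\<close> in
    \<open>T - U\<close> then makes both transfers feasible.\<close>
  obtain U where U: "tight x U" "s \<notin> U"
    and U_max: "\<And>Z. tight x Z \<Longrightarrow> s \<notin> Z \<Longrightarrow> card (- U) \<le> card (- Z)"
    using ex_has_least_nat[of "\<lambda>Z. tight x Z \<and> s \<notin> Z" "{}" "\<lambda>Z. card (- Z)"] tight_empty by auto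
  have T_sub: "T \<subseteq> Z" if "tight y Z" "s \<in> Z" for Z
  proof -
    have "card T \<le> card (T \<inter> Z)"
      using T_min tight_Un_Int[OF y T(1) that(1)] T(2) that(2) by simp
    then have "T \<inter> Z = T" by (intro card_seteq) auto
    then show ?thesis by blast
  qed
  have U_sup: "Z \<subseteq> U" if "tight x Z" "s \<notin> Z" for Z
  proof -
    have "card (- U) \<le> card (- (U \<union> Z))"
      using tight_Un_Int[OF x U(1) that(1)] U(2) that(2) by (intro U_max) auto
    then have "- (U \<union> Z) = - U" by (intro card_seteq) auto
    then show ?thesis by blast
  qed
  \<comment> \<open>Otherwise \<open>x\<close> dominates \<open>y\<close> on \<open>T - U\<close>,
    strictly at \<open>s\<close>. Trading this part between the sums over \<open>T\<close> and
    \<open>U\<close> then exceeds what submodularity allows for \<open>T \<union> U\<close> and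
    \<open>T \<inter> U\<close>.\<close>
  have "\<exists>t\<in>T - U. x $ t < y $ t"
  proof (rule ccontr)
    assume "\<not> (\<exists>t\<in>T - U. x $ t < y $ t)"
    then have "(\<Sum>i\<in>T - U. y $ i) < (\<Sum>i\<in>T - U. x $ i)"
      using s T(2) U(2) by (intro sum_strict_mono_ex1) (auto simp: not_less)
    moreover have "(\<Sum>i\<in>T. y $ i) = (\<Sum>i\<in>T \<inter> U. y $ i) + (\<Sum>i\<in>T - U. y $ i)"
      by (simp add: sum.Int_Diff)
    moreover have "(\<Sum>i\<in>T \<union> U. x $ i) = (\<Sum>i\<in>U. x $ i) + (\<Sum>i\<in>T - U. x $ i)"
      by (subst sum.union_disjoint[symmetric]) (auto intro: arg_cong2[where f = sum])
    ultimately have "(\<Sum>i\<in>T. y $ i) + (\<Sum>i\<in>U. x $ i)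
        < (\<Sum>i\<in>T \<union> U. x $ i) + (\<Sum>i\<in>T \<inter> U. y $ i)"
      by linarith
    moreover have "ereal (real_of_int (\<Sum>i\<in>T \<union> U. x $ i)) + ereal (real_of_int (\<Sum>i\<in>T \<inter> U. y $ i))
        \<le> ereal (real_of_int (\<Sum>i\<in>T. y $ i)) + ereal (real_of_int (\<Sum>i\<in>U. x $ i))"
    proof -
      have "ereal (real_of_int (\<Sum>i\<in>T \<union> U. x $ i)) + ereal (real_of_int (\<Sum>i\<in>T \<inter> U. y $ i))
          \<le> b (T \<union> U) + b (T \<inter> U)"
        by (intro add_mono points_le x y)
      also have "\<dots> \<le> b T + b U"
        using submod by (simp add: submodular_def)
      finally show ?thesis using T(1) U(1) by (simp add: tight_def)
    qed
    then have "(\<Sum>i\<in>T \<union> U. x $ i) + (\<Sum>i\<in>T \<inter> U. y $ i) \<le> (\<Sum>i\<in>T. y $ i) + (\<Sum>i\<in>U. x $ i)"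
      by (simp only: plus_ereal.simps ereal_less_eq of_int_le_iff flip: of_int_add)
    ultimately show False by linarith
  qed
  then obtain t where t: "t \<in> T" "t \<notin> U" "x $ t < y $ t" by blast
  with s have "s \<noteq> t" by auto
  show ?thesis
  proof (rule that[OF t(3)])
    show "transfer x t s \<in> points"
      using \<open>s \<noteq> t\<close> U_sup t(2) by (intro transfer_in_points x) auto
    show "transfer y s t \<in> points"
      using \<open>s \<noteq> t\<close> T_sub t(1) by (intro transfer_in_points y) auto
  qed
qed


subsection \<open>Local minimality implies global minimality\<close>

text \<open>The relation \<open>le\<close> is kept abstract to serve both notions of minimality. It
  is only a preorder: distinct vectors may share their value of \<Phi> or their sorted list.\<close>

lemma local_min_imp_min:
  assumes m: "m \<in> points" and y: "y \<in> points"
    and local_min: "\<And>s t. transfer m s t \<in> points \<Longrightarrow> m $ t \<le> m $ s + 1"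
    and refl: "\<And>u. le u u" and trans: "\<And>u v w. le u v \<Longrightarrow> le v w \<Longrightarrow> le u w"
    and le_transfer: "\<And>u s t. u $ s < u $ t \<Longrightarrow> le (transfer u s t) u"
  shows "le m y"
  using y
proof (induction "nat (\<Sum>i\<in>UNIV. \<bar>m $ i - y $ i\<bar>)" arbitrary: y rule: less_induct)
  case less
  show ?case
  proof (cases "m = y")
    case True
    then show ?thesis by (simp add: refl)
  next
    case False
    \<comment> \<open>Equal totals ensure that \<open>y\<close>, being different from
      \<open>m\<close>, lies below it somewhere; the exchange starts at such a coordinate.\<close>
    have sum_eq: "(\<Sum>i\<in>UNIV. m $ i) = (\<Sum>i\<in>UNIV. y $ i)"
    proof -
      have "ereal (real_of_int (\<Sum>i\<in>UNIV. m $ i)) = ereal (real_of_int (\<Sum>i\<in>UNIV. y $ i))"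
        using m less.prems by (simp add: points_iff tight_def)
      then show ?thesis by (simp only: ereal.inject of_int_eq_iff)
    qed
    have "\<exists>s. y $ s < m $ s"
    proof (rule ccontr)
      assume "\<not> (\<exists>s. y $ s < m $ s)"
      then have le: "m $ i \<le> y $ i" for i by (simp add: not_less)
      obtain i where "m $ i \<noteq> y $ i" using False by (auto simp: vec_eq_iff)
      with le have "m $ i < y $ i" by (simp add: order_less_le)
      then have "(\<Sum>i\<in>UNIV. m $ i) < (\<Sum>i\<in>UNIV. y $ i)"
        using le by (intro sum_strict_mono_ex1) auto
      with sum_eq show False by simp
    qed
    then obtain s where s: "y $ s < m $ s" ..
    from simultaneous_exchange[OF m less.prems s] obtain t
      where t: "m $ t < y $ t" "transfer m t s \<in> points" "transfer y s t \<in> points" .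
    have "m $ s \<le> m $ t + 1" by (rule local_min[OF t(2)])
    with s t(1) have "y $ s < y $ t" by linarith
    then have "le (transfer y s t) y" by (rule le_transfer)
    \<comment> \<open>The transfer moves \<open>y\<close> one unit towards \<open>m\<close> at both
      \<open>s\<close> and \<open>t\<close>.\<close>
    moreover have "(\<Sum>i\<in>UNIV. \<bar>m $ i - transfer y s t $ i\<bar>) < (\<Sum>i\<in>UNIV. \<bar>m $ i - y $ i\<bar>)"
      using s t(1) by (intro sum_strict_mono_ex1) (auto simp: transfer_nth)
    then have "nat (\<Sum>i\<in>UNIV. \<bar>m $ i - transfer y s t $ i\<bar>) < nat (\<Sum>i\<in>UNIV. \<bar>m $ i - y $ i\<bar>)"
      by (simp add: zless_nat_conj sum_nonneg order.strict_trans1[rotated])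
    then have "le m (transfer y s t)" using t(3) by (rule less.hyps)
    ultimately show ?thesis using trans by blast
  qed
qed

end


subsection \<open>Effect of a transfer on symmetric strictly convex functions\<close>

text \<open>At gap one the move only exchanges two values, so neither symmetric functions nor sorted
  vectors notice it. This supplies the weak inequality where the strict ones do not apply.\<close>

lemma transfer_adjacent:
  assumes "u $ t = u $ s + 1"
  shows "transfer u s t = (\<chi> i. u $ Transposition.transpose s t i)"
  using assms by (auto simp: vec_eq_iff transfer_nth Transposition.transpose_def)

lemma strictly_convex_transfer_less:
  fixes \<Phi> :: "int ^ 'n::finite \<Rightarrow> real"
  assumes sym: "symmetric_fun \<Phi>" and conv: "strictly_convex_int \<Phi>" and gap: "u $ s + 1 < u $ t"
  shows "\<Phi> (transfer u s t) < \<Phi> u"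
proof -
  define v where "v = (\<chi> i. u $ Transposition.transpose s t i)"
  define d where "d = real_of_int (u $ t - u $ s)"
  \<comment> \<open>The difference \<open>v - u\<close> is \<open>d\<close> at \<open>s\<close>,
    \<open>- d\<close> at \<open>t\<close> and zero elsewhere, so going the fraction
    \<open>1 / d\<close> of the way from \<open>u\<close> to \<open>v\<close> moves exactly one
    unit. A gap above one makes \<open>l\<close> positive.\<close>
  define l where "l = 1 - 1 / d"
  have d: "d > 1" using gap by (simp add: d_def)
  have v: "\<Phi> v = \<Phi> u"
    using sym by (simp add: v_def symmetric_fun_def permutes_swap_id)
  have "u $ s \<noteq> v $ s" using gap by (simp add: v_def)
  then have "u \<noteq> v" by auto
  moreover have "0 < l" "l < 1" using d by (auto simp: l_def)
  moreover have "real_vec (transfer u s t) = l *\<^sub>R real_vec u + (1 - l) *\<^sub>R real_vec v"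
  proof -
    have ld: "(1 - l) * d = 1" using d by (simp add: l_def)
    have "real_of_int (transfer u s t $ i) = l * real_of_int (u $ i) + (1 - l) * real_of_int (v $ i)" for i
    proof -
      have "l * real_of_int (u $ i) + (1 - l) * real_of_int (v $ i)
          = real_of_int (u $ i) + (1 - l) * real_of_int (v $ i - u $ i)"
        by (simp add: algebra_simps)
      also have "real_of_int (v $ i - u $ i) = (if i = s then d else if i = t then - d else 0)"
        by (simp add: v_def d_def Transposition.transpose_def)
      finally show ?thesis using ld gap by (auto simp: transfer_nth)
    qed
    then show ?thesis by (simp add: vec_eq_iff real_vec_def)
  qed
  ultimately have "\<Phi> (transfer u s t) < l * \<Phi> u + (1 - l) * \<Phi> v"
    using conv by (simp add: strictly_convex_int_def)
  also have "\<dots> = \<Phi> u" by (simp add: v algebra_simps)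
  finally show ?thesis .
qed

lemma strictly_convex_transfer_le:
  fixes \<Phi> :: "int ^ 'n::finite \<Rightarrow> real"
  assumes sym: "symmetric_fun \<Phi>" and conv: "strictly_convex_int \<Phi>" and gap: "u $ s < u $ t"
  shows "\<Phi> (transfer u s t) \<le> \<Phi> u"
proof (cases "u $ t = u $ s + 1")
  case True
  then show ?thesis
    using sym by (simp add: transfer_adjacent symmetric_fun_def permutes_swap_id)
next
  case False
  then show ?thesis
    using strictly_convex_transfer_less[OF sym conv, of u s t] gap by simp
qed


subsection \<open>Effect of a transfer on the decreasing order\<close>

text \<open>The lists agree until \<open>xs\<close> has used up its copies of \<open>c\<close>. At
  the next position \<open>ys\<close> still has \<open>c\<close>, while \<open>xs\<close> has a
  smaller entry or has ended; a proper prefix counts as smaller in \<open>lexord\<close>.\<close>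

lemma lexord_if_count_less:
  fixes c :: "'a::linorder"
  assumes "sorted_wrt (\<ge>) xs" "sorted_wrt (\<ge>) ys"
    and "\<And>v. c < v \<Longrightarrow> count (mset xs) v = count (mset ys) v"
    and "count (mset xs) c < count (mset ys) c"
  shows "(xs, ys) \<in> lexord {(a, b). a < b}"
  using assms
proof (induction xs arbitrary: ys)
  case Nil
  then show ?case by (cases ys) auto
next
  case (Cons x xs)
  then obtain y ys' where ys: "ys = y # ys'" by (cases ys) auto
  have "c \<in># mset ys" using Cons.prems(4) by (metis count_inI not_less_zero)
  then have "c \<le> y" using Cons.prems(2) ys by auto
  consider "x < y" | "x = y" | "y < x" by fastforce
  then show ?case
  proof cases
    case 1
    then show ?thesis by (simp add: ys)
  next
    case 2
    have "(xs, ys') \<in> lexord {(a, b). a < b}"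
    proof (rule Cons.IH)
      show "count (mset xs) v = count (mset ys') v" if "c < v" for v
        using Cons.prems(3)[OF that] by (simp add: ys 2 split: if_splits)
      show "count (mset xs) c < count (mset ys') c"
        using Cons.prems(4) by (simp add: ys 2 split: if_splits)
    qed (use Cons.prems ys in auto)
    then show ?thesis by (simp add: ys 2)
  next
    case 3
    \<comment> \<open>This case is impossible: \<open>x\<close> lies above \<open>c\<close>, so it
      would also occur in \<open>ys\<close>, whose largest entry is \<open>y\<close>.\<close>
    with \<open>c \<le> y\<close> have "count (mset (x # xs)) x = count (mset ys) x"
      by (intro Cons.prems(3)) simp
    then have "count (mset ys) x \<noteq> 0" by (metis count_eq_zero_iff list.set_intros(1) set_mset_mset)
    then have "x \<in># mset ys" by (metis count_inI)
    then have "x \<in> set ys" by simp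
    then show ?thesis using Cons.prems(2) ys 3 by auto
  qed
qed

lemma sorted_sort_decreasing: "sorted_wrt (\<ge>) (sort_decreasing x)"
  by (simp add: sort_decreasing_def sorted_wrt_rev)

lemma mset_sort_decreasing: "mset (sort_decreasing x) = image_mset (($) x) (mset_set UNIV)"
  by (simp add: sort_decreasing_def)

lemma count_sort_decreasing: "count (mset (sort_decreasing x)) v = card {i. x $ i = v}"
  by (simp add: mset_sort_decreasing count_image_mset vimage_def)

text \<open>The raised coordinate \<open>s\<close> stays below the old value of \<open>t\<close>, so
  that value loses the occurrence at \<open>t\<close> and gains none, and nothing above it
  changes.\<close>

lemma sort_decreasing_transfer_less:
  fixes u :: "int ^ 'n::finite"
  assumes gap: "u $ s + 1 < u $ t"
  shows "(sort_decreasing (transfer u s t), sort_decreasing u) \<in> lexord {(a, b). a < b}"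
proof (rule lexord_if_count_less[where c = "u $ t"])
  show "count (mset (sort_decreasing (transfer u s t))) v = count (mset (sort_decreasing u)) v"
    if "u $ t < v" for v
  proof -
    have "{i. transfer u s t $ i = v} = {i. u $ i = v}"
      using gap that by (auto simp: transfer_nth)
    then show ?thesis by (simp add: count_sort_decreasing)
  qed
  have "t \<notin> {i. transfer u s t $ i = u $ t}" "s \<noteq> t"
    using gap by (auto simp: transfer_nth)
  moreover have "{i. transfer u s t $ i = u $ t} \<subseteq> {i. u $ i = u $ t}"
    using gap by (auto simp: transfer_nth split: if_splits)
  ultimately have "{i. transfer u s t $ i = u $ t} \<subset> {i. u $ i = u $ t}"
    by blast
  then show "count (mset (sort_decreasing (transfer u s t))) (u $ t) < count (mset (sort_decreasing u)) (u $ t)"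
    by (simp add: count_sort_decreasing psubset_card_mono)
qed (rule sorted_sort_decreasing)+

lemma sort_decreasing_permute:
  fixes u :: "'a::linorder ^ 'n::finite"
  assumes "\<pi> permutes UNIV"
  shows "sort_decreasing (\<chi> i. u $ \<pi> i) = sort_decreasing u"
proof -
  have "image_mset (($) (\<chi> i. u $ \<pi> i)) (mset_set UNIV) = image_mset (($) u) (image_mset \<pi> (mset_set UNIV))"
    unfolding multiset.map_comp by (intro image_mset_cong) simp
  also have "image_mset \<pi> (mset_set UNIV) = mset_set UNIV"
    using assms by (simp add: image_mset_mset_set permutes_inj permutes_surj)
  finally show ?thesis by (simp only: sort_decreasing_def)
qed

lemma sort_decreasing_transfer_le:
  fixes u :: "int ^ 'n::finite"
  assumes "u $ s < u $ t"
  shows "lex_le (sort_decreasing (transfer u s t)) (sort_decreasing u)"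
proof (cases "u $ t = u $ s + 1")
  case True
  then show ?thesis
    by (simp add: transfer_adjacent sort_decreasing_permute permutes_swap_id lex_le_def)
next
  case False
  then show ?thesis
    using sort_decreasing_transfer_less[of u s t] assms by (simp add: lex_le_def)
qed

lemma lex_le_trans: "lex_le xs ys \<Longrightarrow> lex_le ys zs \<Longrightarrow> lex_le xs zs"
  unfolding lex_le_def
  by (metis (no_types, lifting) lexord_trans case_prodD case_prodI mem_Collect_eq order.strict_trans transI)

lemma not_lex_le_if_lexord:
  assumes "(ys, xs) \<in> lexord {(a, b::'a::linorder). a < b}"
  shows "\<not> lex_le xs ys"
proof
  assume "lex_le xs ys"
  moreover have "trans {(a, b::'a). a < b}" by (auto intro: transI)
  ultimately have "(ys, ys) \<in> lexord {(a, b::'a). a < b}"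
    using assms lexord_trans[OF assms, of ys] unfolding lex_le_def by blast
  then show False by (simp add: lexord_irreflexive)
qed


section \<open>Both kinds of minimality coincide with local minimality\<close>

theorem theorem6p4:
  fixes B :: "(real ^ 'n::finite) set"
    and \<Phi> :: "int ^ 'n \<Rightarrow> real"
    and m :: "int ^ 'n"
  assumes "integral_base_polyhedron B"
    and "symmetric_fun \<Phi>"
    and "strictly_convex_int \<Phi>"
    and "m \<in> integral_points B"
  shows "is_arg_min \<Phi> (\<lambda>z. z \<in> integral_points B) m \<longleftrightarrow> dec_min (integral_points B) m"
proof -
  from assms(1) obtain b where b: "integer_valued b" "submodular b" "b {} = 0"
    and B: "B = base_polyhedron b"
    unfolding integral_base_polyhedron_def by blast
  interpret integral_base b by unfold_locales (fact b)+
  have P: "integral_points B = points" by (simp add: B points_def)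
  have m: "m \<in> points" using assms(4) P by simp
  \<comment> \<open>Pairs with \<open>s = t\<close> satisfy this condition trivially and need no
    exclusion.\<close>
  define local_min where
    "local_min \<longleftrightarrow> (\<forall>s t. transfer m s t \<in> points \<longrightarrow> m $ t \<le> m $ s + 1)"
  have "is_arg_min \<Phi> (\<lambda>z. z \<in> points) m \<longleftrightarrow> local_min"
  proof
    assume min: "is_arg_min \<Phi> (\<lambda>z. z \<in> points) m"
    show local_min unfolding local_min_def
    proof (intro allI impI leI notI)
      fix s t assume "transfer m s t \<in> points" "m $ s + 1 < m $ t"
      then show False
        using strictly_convex_transfer_less[OF assms(2,3)] min by (auto simp: is_arg_min_def)
    qed
  next
    assume local_min
    then have "\<Phi> m \<le> \<Phi> y" if "y \<in> points" for y
      using strictly_convex_transfer_le[OF assms(2,3)] that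
      by (intro local_min_imp_min[OF m, where le = "\<lambda>u v. \<Phi> u \<le> \<Phi> v"]) (auto simp: local_min_def)
    then show "is_arg_min \<Phi> (\<lambda>z. z \<in> points) m"
      using m by (simp add: is_arg_min_linorder)
  qed
  also have "local_min \<longleftrightarrow> dec_min points m"
  proof
    assume local_min
    \<comment> \<open>The same induction applies, now with vectors compared through their sorted
      lists.\<close>
    then have "lex_le (sort_decreasing m) (sort_decreasing y)" if "y \<in> points" for y
      using sort_decreasing_transfer_le that
      by (intro local_min_imp_min[OF m,
            where le = "\<lambda>u v. lex_le (sort_decreasing u) (sort_decreasing v)"])
         (auto simp: local_min_def lex_le_def[of xs xs for xs] intro: lex_le_trans)
    then show "dec_min points m" using m by (simp add: dec_min_def)
  next
    assume min: "dec_min points m"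
    show local_min unfolding local_min_def
    proof (intro allI impI leI notI)
      fix s t assume "transfer m s t \<in> points" "m $ s + 1 < m $ t"
      then show False
        using not_lex_le_if_lexord[OF sort_decreasing_transfer_less] min
        by (auto simp: dec_min_def)
    qed
  qed
  finally show ?thesis by (simp add: P)
qed

end
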